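(* Let $\Omega$ be a Banach space of functions with Schauder basis $\{\Phi_i\}_{i=1}^\infty$, and let $f:L_{\text{bound}}(\Omega)\to\mathbb{R}$ be a functional satisfying the finite dimensional summation assumption with sets $\{\mathbb{D}_j\}_{j=1}^\infty$ and components $f_j$. Suppose moreover that: (i) (Smoothness) for any $j\in\mathbb{N}_+$, $f_j\left(\sum_{i\in\mathbb{D}_j}b_i\Phi_i\right)$ is a $C^1$ function with respect to the variables $b_i$, $i\in\mathbb{D}_j$, in $\left(-\frac12,\frac12\right)^{|\mathbb{D}_j|}$; (ii) (Existence of $a_{\boldsymbol{k}}(f)$) for each $\boldsymbol{k}\in\mathbb{K}$ the Fourier coefficient $a_{\boldsymbol{k}}(f)$ exists, and $$\sum_{\boldsymbol{k}\in\mathbb{K}}\sum_{j\in\mathbb{A}_{\boldsymbol{k}}}\left|\int_{\left(-\frac12,\frac12\right)^{|\mathbb{D}_j|}}f_j\Big(\sum_{i\in\mathbb{D}_j}b_i\Phi_i\Big)\Big[\prod_{i\in\mathbb{D}_j}\exp(-2\pi \mathrm{i}\,k_ib_i)\,\mathrm{d}b_i\Big]\right|<\infty .$$ Then $$f(v)=\sum_{\boldsymbol{k}\in\mathbb{K}}a_{\boldsymbol{k}}(f)\,e_{\boldsymbol{k}}(v)\qquad\text{for all } v\in L_{\text{bound}}(\Omega),$$ and this series is unconditionally convergent.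
   Context: $\Omega$ is a Banach space of functions with Schauder basis $\{\Phi_i\}_{i=1}^\infty$ (real scalars): every $v\in\Omega$ is uniquely $v=\sum_{i=1}^\infty b_i\Phi_i$ with $b_i\in\mathbb{R}$. Set $L_{\text{bound}}(\Omega):=\{v=\sum_{i=1}^\infty b_i\Phi_i\in\Omega:\ -\frac12<b_i<\frac12,\ i\in\mathbb{N}_+\}$. Index set: $\mathbb{K}:=\bigcup_{m=1}^\infty\mathbb{K}^m$, where $\mathbb{K}^m$ is the set of integer sequences $\boldsymbol{k}=(k_1,k_2,\dots)\in\mathbb{Z}^\infty$ with $N_{\boldsymbol{k}}:=\max\{i:k_i\neq0\}\le m$; thus $\mathbb{K}$ is the set of integer sequences with finitely many nonzero entries (including the zero sequence). Fourier basis: for $\boldsymbol{k}\in\mathbb{K}$ and $v=\sum_i b_i\Phi_i\in L_{\text{bound}}(\Omega)$, $e_{\boldsymbol{k}}(v):=\exp\left(\sum_{i=1}^\infty2\pi \mathrm{i}\,k_ib_i\right)$ (where $\mathrm{i}$ in front of $k_i$ is the imaginary unit). Finite dimensional summation assumption on $f$: for the basis $\{\Phi_i\}$ there is a unique sequence of sets $\{\mathbb{D}_j\}_{j=1}^\infty$, $\mathbb{D}_j\subset\mathbb{N}_+$, $|\mathbb{D}_j|<\infty$, such that $f\left(\sum_{i=1}^\infty b_i\Phi_i\right)=\sum_{j=1}^\infty f_j\left(\sum_{i\in\mathbb{D}_j}b_i\Phi_i\right)$ for all $v=\sum_i b_i\Phi_i\in L_{\text{bound}}(\Omega)$, where no $f_j\left(\sum_{i\in\mathbb{D}_j}b_i\Phi_i\right)$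 can be further divided into (written as a sum of) $f_j^{(1)}\left(\sum_{i\in\mathbb{D}_j^1}b_i\Phi_i\right)$ and $f_j^{(2)}\left(\sum_{i\in\mathbb{D}_j^2}b_i\Phi_i\right)$ with $|\mathbb{D}_j^1|,|\mathbb{D}_j^2|<|\mathbb{D}_j|$. The sets $\mathbb{D}_j$ need not be disjoint. Fourier coefficients: for $f$ satisfying this assumption, $$a_{\boldsymbol{k}}(f):=\sum_{j\in\mathbb{A}_{\boldsymbol{k}}}\int_{\left(-\frac12,\frac12\right)^{|\mathbb{D}_j|}}f_j\Big(\sum_{i\in\mathbb{D}_j}b_i\Phi_i\Big)\Big[\prod_{i\in\mathbb{D}_j}\exp(-2\pi \mathrm{i}\,k_ib_i)\,\mathrm{d}b_i\Big],$$ where $\mathbb{K}_{\mathbb{D}_j}:=\{\boldsymbol{k}\in\mathbb{K}:k_i=0\text{ for }i\notin\mathbb{D}_j\}$ and $\mathbb{A}_{\boldsymbol{k}}:=\{j\in\mathbb{N}_+:\boldsymbol{k}\in\mathbb{K}_{\mathbb{D}_j}\}$. *)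

theory Defs
  imports "HOL-Analysis.Analysis"
begin

text \<open>
  Basis vectors, coordinates and the components of \<open>f\<close> are numbered from 0 instead of 1.
\<close>

definition schauder_basis :: "(nat \<Rightarrow> 'a::banach) \<Rightarrow> bool" where
  "schauder_basis \<Phi> \<longleftrightarrow> (\<forall>v. \<exists>!b :: nat \<Rightarrow> real. (\<lambda>i. b i *\<^sub>R \<Phi> i) sums v)"

definition coord :: "(nat \<Rightarrow> 'a::banach) \<Rightarrow> 'a \<Rightarrow> nat \<Rightarrow> real" where
  "coord \<Phi> v = (THE b. (\<lambda>i. b i *\<^sub>R \<Phi> i) sums v)"

definition L_bound :: "(nat \<Rightarrow> 'a::banach) \<Rightarrow> 'a set" where
  "L_bound \<Phi> = {v. \<forall>i. - 1/2 < coord \<Phi> v i \<and> coord \<Phi> v i < 1/2}"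

definition part :: "(nat \<Rightarrow> 'a::banach) \<Rightarrow> nat set \<Rightarrow> 'a \<Rightarrow> 'a" where
  "part \<Phi> S v = (\<Sum>i\<in>S. coord \<Phi> v i *\<^sub>R \<Phi> i)"

definition divisible :: "(nat \<Rightarrow> 'a::banach) \<Rightarrow> nat set \<Rightarrow> ('a \<Rightarrow> real) \<Rightarrow> bool" where
  "divisible \<Phi> S g \<longleftrightarrow>
     (\<exists>S1 S2 g1 g2. finite S1 \<and> finite S2 \<and> card S1 < card S \<and> card S2 < card S \<and>
        (\<forall>v\<in>L_bound \<Phi>. g (part \<Phi> S v) = (g1 (part \<Phi> S1 v) + g2 (part \<Phi> S2 v) :: real)))"

definition indivisible_decomposition ::
  "(nat \<Rightarrow> 'a::banach) \<Rightarrow> ('a \<Rightarrow> real) \<Rightarrow> (nat \<Rightarrow> nat set) \<Rightarrow> (nat \<Rightarrow> 'a \<Rightarrow> real) \<Rightarrow> bool" where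
  "indivisible_decomposition \<Phi> f D fs \<longleftrightarrow>
     (\<forall>j. finite (D j)) \<and>
     (\<forall>v\<in>L_bound \<Phi>. (\<lambda>j. fs j (part \<Phi> (D j) v)) sums f v) \<and>
     (\<forall>j. \<not> divisible \<Phi> (D j) (fs j))"

text \<open>
  The sets \<open>D j\<close> are required to be unique relative to the summands
  \<open>v \<mapsto> fs j (part \<Phi> (D j) v)\<close>. They cannot be unique relative to \<open>f\<close> alone: the sequence
  may be reordered, and \<open>fs\<close> may be extended by two summands
  \<open>g\<close> and \<open>- g\<close> that depend on a single coordinate.
\<close>

definition finite_dim_summation ::
  "(nat \<Rightarrow> 'a::banach) \<Rightarrow> ('a \<Rightarrow> real) \<Rightarrow> (nat \<Rightarrow> nat set) \<Rightarrow> (nat \<Rightarrow> 'a \<Rightarrow> real) \<Rightarrow> bool" where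
  "finite_dim_summation \<Phi> f D fs \<longleftrightarrow>
     indivisible_decomposition \<Phi> f D fs \<and>
     (\<forall>D' fs'. indivisible_decomposition \<Phi> f D' fs' \<longrightarrow>
        (\<forall>j. \<forall>v\<in>L_bound \<Phi>. fs' j (part \<Phi> (D' j) v) = fs j (part \<Phi> (D j) v)) \<longrightarrow> D' = D)"

definition freqs :: "(nat \<Rightarrow> int) set" where
  "freqs = {k. finite {i. k i \<noteq> 0}}"

definition freqs_on :: "nat set \<Rightarrow> (nat \<Rightarrow> int) set" where
  "freqs_on S = {k \<in> freqs. \<forall>i. i \<notin> S \<longrightarrow> k i = 0}"

definition active :: "(nat \<Rightarrow> nat set) \<Rightarrow> (nat \<Rightarrow> int) \<Rightarrow> nat set" where
  "active D k = {j. k \<in> freqs_on (D j)}"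

definition fourier_basis :: "(nat \<Rightarrow> 'a::banach) \<Rightarrow> (nat \<Rightarrow> int) \<Rightarrow> 'a \<Rightarrow> complex" where
  "fourier_basis \<Phi> k v =
     exp (\<Sum>n. 2 * of_real pi * \<i> * of_int (k n) * of_real (coord \<Phi> v n))"

text \<open>
  A point of the cube over \<open>S\<close> is a function that is \<open>undefined\<close> outside \<open>S\<close>, as in the space
  of the product measure \<open>PiM S (\<lambda>_. lborel)\<close>. On such functions the topology of
  \<open>nat \<Rightarrow> real\<close> is that of the finite power of \<open>real\<close> indexed by \<open>S\<close>.
\<close>

definition cube :: "nat set \<Rightarrow> (nat \<Rightarrow> real) set" where
  "cube S = (\<Pi>\<^sub>E i\<in>S. {- 1/2 <..< 1/2})"

definition C1_on_cube :: "nat set \<Rightarrow> ((nat \<Rightarrow> real) \<Rightarrow> real) \<Rightarrow> bool" where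
  "C1_on_cube S F \<longleftrightarrow>
     continuous_on (cube S) F \<and>
     (\<exists>F'. \<forall>i\<in>S. continuous_on (cube S) (F' i) \<and>
        (\<forall>b\<in>cube S. ((\<lambda>t. F (b(i := t))) has_real_derivative F' i b) (at (b i))))"

definition in_coords :: "(nat \<Rightarrow> 'a::banach) \<Rightarrow> nat set \<Rightarrow> ('a \<Rightarrow> real) \<Rightarrow> (nat \<Rightarrow> real) \<Rightarrow> real" where
  "in_coords \<Phi> S g b = g (\<Sum>i\<in>S. b i *\<^sub>R \<Phi> i)"

definition fourier_integrand ::
  "(nat \<Rightarrow> 'a::banach) \<Rightarrow> nat set \<Rightarrow> ('a \<Rightarrow> real) \<Rightarrow> (nat \<Rightarrow> int) \<Rightarrow> (nat \<Rightarrow> real) \<Rightarrow> complex" where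
  "fourier_integrand \<Phi> S g k b =
     of_real (in_coords \<Phi> S g b) *
     (\<Prod>n\<in>S. exp (- 2 * of_real pi * \<i> * of_int (k n) * of_real (b n)))"

definition fourier_integral ::
  "(nat \<Rightarrow> 'a::banach) \<Rightarrow> nat set \<Rightarrow> ('a \<Rightarrow> real) \<Rightarrow> (nat \<Rightarrow> int) \<Rightarrow> complex" where
  "fourier_integral \<Phi> S g k =
     (LINT b:cube S|PiM S (\<lambda>_. lborel). fourier_integrand \<Phi> S g k b)"

definition fourier_coeff_exists ::
  "(nat \<Rightarrow> 'a::banach) \<Rightarrow> (nat \<Rightarrow> nat set) \<Rightarrow> (nat \<Rightarrow> 'a \<Rightarrow> real) \<Rightarrow> (nat \<Rightarrow> int) \<Rightarrow> bool" where
  "fourier_coeff_exists \<Phi> D fs k \<longleftrightarrow>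
     (\<forall>j\<in>active D k. set_integrable (PiM (D j) (\<lambda>_. lborel)) (cube (D j))
                        (fourier_integrand \<Phi> (D j) (fs j) k)) \<and>
     (\<lambda>j. fourier_integral \<Phi> (D j) (fs j) k) summable_on active D k"

definition fourier_coeff ::
  "(nat \<Rightarrow> 'a::banach) \<Rightarrow> (nat \<Rightarrow> nat set) \<Rightarrow> (nat \<Rightarrow> 'a \<Rightarrow> real) \<Rightarrow> (nat \<Rightarrow> int) \<Rightarrow> complex" where
  "fourier_coeff \<Phi> D fs k =
     (\<Sum>\<^sub>\<infinity>j\<in>active D k. fourier_integral \<Phi> (D j) (fs j) k)"

lemma coord_sums:
  assumes "schauder_basis \<Phi>"
  shows "(\<lambda>i. coord \<Phi> v i *\<^sub>R \<Phi> i) sums v"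
  unfolding coord_def
  using theI'[of "\<lambda>b. (\<lambda>i. b i *\<^sub>R \<Phi> i) sums v"] assms
  by (auto simp: schauder_basis_def)

lemma coord_eqI:
  assumes "schauder_basis \<Phi>" "(\<lambda>i. b i *\<^sub>R \<Phi> i) sums v"
  shows "coord \<Phi> v = b"
  using coord_sums[OF assms(1), of v] assms unfolding schauder_basis_def by blast

lemma coord_part:
  assumes "schauder_basis \<Phi>" "finite S"
  shows "coord \<Phi> (part \<Phi> S v) = (\<lambda>i. if i \<in> S then coord \<Phi> v i else 0)"
proof (rule coord_eqI[OF assms(1)])
  have "(\<lambda>i. (if i \<in> S then coord \<Phi> v i else 0) *\<^sub>R \<Phi> i)
          sums (\<Sum>i\<in>S. (if i \<in> S then coord \<Phi> v i else 0) *\<^sub>R \<Phi> i)"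
    by (rule sums_finite[OF assms(2)]) auto
  then show "(\<lambda>i. (if i \<in> S then coord \<Phi> v i else 0) *\<^sub>R \<Phi> i) sums part \<Phi> S v"
    by (simp add: part_def)
qed

lemma part_part:
  assumes "schauder_basis \<Phi>" "finite S" "finite T"
  shows "part \<Phi> S (part \<Phi> T v) = part \<Phi> (S \<inter> T) v"
  unfolding part_def[of \<Phi> S] part_def[of \<Phi> "S \<inter> T"] coord_part[OF assms(1,3)]
  using assms(2) by (auto simp: sum.inter_restrict intro!: sum.cong)

lemma part_L_bound:
  assumes "schauder_basis \<Phi>" "finite S" "v \<in> L_bound \<Phi>"
  shows "part \<Phi> S v \<in> L_bound \<Phi>"
  using assms by (auto simp: L_bound_def coord_part)

lemma indivisible_support_subset:
  assumes basis: "schauder_basis \<Phi>"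
    and fin: "finite S" "finite T"
    and indiv: "\<not> divisible \<Phi> S g"
    and eq: "\<forall>v\<in>L_bound \<Phi>. g (part \<Phi> S v) = h (part \<Phi> T v)"
  shows "S \<subseteq> T"
proof (rule ccontr)
  assume "\<not> S \<subseteq> T"
  then have "S \<inter> T \<subset> S" by auto
  then have card: "card (S \<inter> T) < card S" by (rule psubset_card_mono[OF fin(1)])
  have "g (part \<Phi> S v) = g (part \<Phi> (S \<inter> T) v) + (\<lambda>_. 0) (part \<Phi> {} v)"
    if v: "v \<in> L_bound \<Phi>" for v
  proof -
    have "g (part \<Phi> S v) = h (part \<Phi> T (part \<Phi> T v))"
      using eq v part_part[OF basis fin(2,2), of v] by simp
    also have "\<dots> = g (part \<Phi> S (part \<Phi> T v))"
      using eq part_L_bound[OF basis fin(2) v] by simp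
    finally show ?thesis by (simp add: part_part[OF basis fin])
  qed
  moreover have "card ({} :: nat set) < card S" using card by simp
  ultimately have "divisible \<Phi> S g"
    unfolding divisible_def using card fin(1) by (meson finite.emptyI finite_Int)
  with indiv show False by contradiction
qed

text \<open>The uniqueness clause is satisfied by every indivisible decomposition.\<close>

lemma finite_dim_summation_iff:
  assumes "schauder_basis \<Phi>"
  shows "finite_dim_summation \<Phi> f D fs \<longleftrightarrow> indivisible_decomposition \<Phi> f D fs"
proof -
  have "D' j = D j"
    if "indivisible_decomposition \<Phi> f D fs" "indivisible_decomposition \<Phi> f D' fs'"
      "\<forall>j. \<forall>v\<in>L_bound \<Phi>. fs' j (part \<Phi> (D' j) v) = fs j (part \<Phi> (D j) v)" for D' fs' j
  proof (rule subset_antisym)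
    show "D' j \<subseteq> D j"
      using that by (intro indivisible_support_subset[OF assms, where g = "fs' j" and h = "fs j"])
        (auto simp: indivisible_decomposition_def)
    show "D j \<subseteq> D' j"
      using that by (intro indivisible_support_subset[OF assms, where g = "fs j" and h = "fs' j"])
        (auto simp: indivisible_decomposition_def)
  qed
  then show ?thesis unfolding finite_dim_summation_def by blast
qed

end

(* Each component fs j equals the sum of its absolutely convergent Fourier series everywhere on the
   open cube over D j: the difference is continuous and integrable with vanishing Fourier
   coefficients, and such a function is zero, because integrating it against the n-th power of
   the trigonometric polynomial prod_i cos^2 (pi (x_i - y_i)), whose only peak in the cube is at y,
   isolates the value at y as n grows. The absolute summability of the double series over (k, j)
   then permits exchanging the sum over j with the sum over k. *)
theory Submission
  imports Defs
begin

section \<open>Characters on the cube\<close>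

text \<open>Nothing is known in advance about a component near the faces of the cube: that it is
  bounded and has a continuous periodic extension only comes out at the end. It compares two
  geometric rates: the \<open>n\<close>-th power of the peak is at least \<open>r ^ n\<close> on a
  small box around \<open>y\<close> and at most \<open>q ^ n\<close> away from \<open>y\<close>.
  Since the box may be chosen after \<open>q\<close>, one can arrange \<open>q < r\<close>; the far
  region then contributes at most \<open>q ^ n\<close> times the integral of the absolute value. The
  factors are \<open>cos\<^sup>2\<close> because this is nonnegative, has period 1, and contains
  only the frequencies -1, 0 and 1, so that multiplying by it preserves the vanishing of all
  coefficients.\<close>

definition cube_measure :: "nat set \<Rightarrow> (nat \<Rightarrow> real) measure" where
  "cube_measure S = restrict_space (PiM S (\<lambda>_. lborel)) (cube S)"

text \<open>A single \<open>cis\<close> of a finite sum makes multiplication of characters an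
  addition of frequencies.\<close>

definition torus_char :: "nat set \<Rightarrow> (nat \<Rightarrow> int) \<Rightarrow> (nat \<Rightarrow> real) \<Rightarrow> complex" where
  "torus_char S k b = cis (2 * pi * (\<Sum>i\<in>S. of_int (k i) * b i))"

section \<open>The cube as a probability space\<close>

interpretation lborel_product: product_sigma_finite "\<lambda>_::nat. lborel :: real measure"
  by standard

lemma cube_sets [measurable]: "finite S \<Longrightarrow> cube S \<in> sets (PiM S (\<lambda>_. lborel))"
  unfolding cube_def by (rule sets_PiM_I_finite) auto

lemma cube_Int_space: "cube S \<inter> space (PiM S (\<lambda>_. lborel)) = cube S"
  by (auto simp: cube_def space_PiM PiE_iff)

lemma space_cube_measure: "space (cube_measure S) = cube S"
  unfolding cube_measure_def space_restrict_space using cube_Int_space by auto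

lemma emeasure_cube_measure_PiE:
  assumes "finite S" "\<And>i. i \<in> S \<Longrightarrow> A i \<in> sets borel" "PiE S A \<subseteq> cube S"
  shows "emeasure (cube_measure S) (PiE S A) = (\<Prod>i\<in>S. emeasure lborel (A i))"
  unfolding cube_measure_def using assms cube_sets[of S]
  by (subst emeasure_restrict_space) (auto simp: cube_Int_space lborel_product.emeasure_PiM)

lemma emeasure_cube: "finite S \<Longrightarrow> emeasure (cube_measure S) (cube S) = 1"
  unfolding cube_def by (subst emeasure_cube_measure_PiE) (auto simp: cube_def)

lemma finite_measure_cube_measure: "finite S \<Longrightarrow> finite_measure (cube_measure S)"
  by standard (simp add: space_cube_measure emeasure_cube)

text \<open>Continuity refers to the topology of \<open>nat \<Rightarrow> real\<close>,
  measurability to the product over \<open>S\<close>. The identity between the two is measurable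
  because every coordinate is: a projection for indices in \<open>S\<close>, the constant
  \<open>undefined\<close> for all others.\<close>

lemma continuous_on_cube_measurable:
  fixes F :: "(nat \<Rightarrow> real) \<Rightarrow> 'b::{topological_space,second_countable_topology}"
  assumes "continuous_on (cube S) F"
  shows "F \<in> borel_measurable (cube_measure S)"
proof -
  have "(\<lambda>x. x) \<in> borel_measurable (PiM S (\<lambda>_. lborel :: real measure))"
  proof (rule measurable_coordinatewise_then_product)
    fix i :: nat
    show "(\<lambda>x. x i) \<in> borel_measurable (PiM S (\<lambda>_. lborel :: real measure))"
    proof (cases "i \<in> S")
      case True
      then show ?thesis using measurable_component_singleton[of i S "\<lambda>_. lborel :: real measure"] by simp
    next
      case False
      then have "x i = undefined" if "x \<in> space (PiM S (\<lambda>_. lborel :: real measure))" for x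
        using that by (auto simp: space_PiM PiE_iff extensional_def)
      then show ?thesis by (subst measurable_cong[where g = "\<lambda>_. undefined"]) auto
    qed
  qed
  then have "(\<lambda>x. x) \<in> measurable (cube_measure S) (restrict_space borel (cube S))"
    unfolding cube_measure_def
    by (intro measurable_restrict_space2 measurable_restrict_space1) (auto simp: space_restrict_space)
  from measurable_compose[OF this borel_measurable_continuous_on_restrict[OF assms]]
  show ?thesis .
qed

section \<open>Characters and their orthogonality\<close>

lemma continuous_on_torus_char [continuous_intros]: "continuous_on A (torus_char S k)"
proof -
  have "continuous_on A (\<lambda>b. b i)" for i and A :: "(nat \<Rightarrow> real) set"
    by (rule continuous_on_subset[OF continuous_on_product_coordinates]) auto
  then show ?thesis
    unfolding torus_char_def cis_conv_exp by (intro continuous_intros)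
qed

lemma torus_char_measurable [measurable]: "torus_char S k \<in> borel_measurable (cube_measure S)"
  by (intro continuous_on_cube_measurable continuous_intros)

lemma norm_torus_char [simp]: "norm (torus_char S k b) = 1"
  by (simp add: torus_char_def)

lemma torus_char_mult: "torus_char S k b * torus_char S l b = torus_char S (\<lambda>i. k i + l i) b"
  by (simp add: torus_char_def cis_mult sum.distrib algebra_simps)

lemma torus_char_zero: "torus_char S (\<lambda>_. 0) b = 1"
  by (simp add: torus_char_def)

lemma torus_char_prod: "finite S \<Longrightarrow> torus_char S k b = (\<Prod>i\<in>S. cis (2 * pi * (of_int (k i) * b i)))"
  by (simp add: torus_char_def cis_conv_exp sum_distrib_left exp_sum)

lemma integral_cis_eq_zero:
  assumes "m \<noteq> (0::int)"
  shows "(\<integral>t. indicator {- 1/2 <..< 1/2} t *\<^sub>R cis (2 * pi * (of_int m * t)) \<partial>lborel) = 0"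
proof -
  define F where "F t = cis (2 * pi * (of_int m * t)) / (2 * pi * \<i> * of_int m)" for t
  have "(LBINT t=ereal (-1/2)..ereal (1/2). cis (2 * pi * (of_int m * t))) = F (1/2) - F (-1/2)"
  proof (rule interval_integral_FTC_finite)
    show "continuous_on {min (-1/2) (1/2)..max (-1/2) (1/2)} (\<lambda>t. cis (2 * pi * (of_int m * t)))"
      unfolding cis_conv_exp by (intro continuous_intros)
    show "(F has_vector_derivative cis (2 * pi * (of_int m * t)))
        (at t within {min (-1/2) (1/2)..max (-1/2) (1/2)})" for t :: real
      unfolding F_def cis_conv_exp using assms
      by (auto intro!: derivative_eq_intros has_vector_derivative_real_field simp: field_simps)
  qed
  also have "F (1/2) - F (-1/2) = 0"
  proof -
    \<comment> \<open>The two phases differ by \<open>2 * pi * m\<close>, a whole number of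
      turns.\<close>
    have "cis (pi * of_int m) = cis (- (pi * of_int m))"
      by (auto simp: complex_eq_iff sin_integer_2pi)
    then show ?thesis by (simp add: F_def)
  qed
  finally show ?thesis
    by (simp add: interval_lebesgue_integral_def set_lebesgue_integral_def)
qed

lemma integral_torus_char:
  assumes "finite S" "k \<in> freqs_on S"
  shows "(\<integral>b. torus_char S k b \<partial>cube_measure S) = (if k = (\<lambda>_. 0) then 1 else 0)"
proof -
  \<comment> \<open>The indicator of the cube is itself a product over coordinates. Absorbing one
    factor into each \<open>g i\<close> leaves a product integrand on the whole space, to which
    Fubini applies.\<close>
  define g where "g i t = indicator {- 1/2 <..< 1/2} t *\<^sub>R cis (2 * pi * (of_int (k i) * t))"
    for i and t :: real
  have int: "integrable lborel (g i)" for i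
  proof -
    have "set_integrable lborel {- 1/2..1/2} (\<lambda>t. cis (2 * pi * (of_int (k i) * t)))"
      unfolding cis_conv_exp by (intro borel_integrable_atLeastAtMost' continuous_intros)
    then have "set_integrable lborel {- 1/2<..<1/2} (\<lambda>t. cis (2 * pi * (of_int (k i) * t)))"
      by (rule set_integrable_subset) auto
    then show ?thesis by (simp add: set_integrable_def g_def[abs_def])
  qed
  have eq: "indicator (cube S) b *\<^sub>R torus_char S k b = (\<Prod>i\<in>S. g i (b i))"
    if b: "b \<in> space (PiM S (\<lambda>_. lborel :: real measure))" for b
  proof (cases "b \<in> cube S")
    case True
    then show ?thesis
      by (auto simp: torus_char_prod assms g_def cube_def PiE_iff intro!: prod.cong)
  next
    case False
    then obtain i where "i \<in> S" "b i \<notin> {- 1/2 <..< 1/2}"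
      using b by (auto simp: cube_def space_PiM PiE_iff)
    then show ?thesis using False assms(1) by (force simp: g_def prod_zero_iff)
  qed
  have "(\<integral>b. torus_char S k b \<partial>cube_measure S) = (\<integral>b. (\<Prod>i\<in>S. g i (b i)) \<partial>PiM S (\<lambda>_. lborel))"
    unfolding cube_measure_def using cube_sets[OF assms(1)]
    by (subst integral_restrict_space) (auto simp: cube_Int_space eq cong: Bochner_Integration.integral_cong)
  also have "\<dots> = (\<Prod>i\<in>S. integral\<^sup>L lborel (g i))"
    by (rule lborel_product.product_integral_prod[OF assms(1) int])
  also have "\<dots> = (if k = (\<lambda>_. 0) then 1 else 0)"
  proof (cases "k = (\<lambda>_. 0)")
    case True
    have "integral\<^sup>L lborel (g i) = (\<integral>t. indicator {- 1/2 <..< 1/2 :: real} t *\<^sub>R 1 \<partial>lborel)" for i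
      by (simp add: g_def[abs_def] True)
    also have "\<dots> = (1::complex)"
      by (subst integral_scaleR_left) auto
    finally show ?thesis using True by simp
  next
    case False
    then obtain i where "k i \<noteq> 0" by auto
    moreover from this have "i \<in> S" using assms(2) by (auto simp: freqs_on_def)
    ultimately show ?thesis
      using integral_cis_eq_zero[of "k i"] assms(1) False by (auto simp: g_def[abs_def] prod_zero_iff)
  qed
  finally show ?thesis .
qed

section \<open>Uniqueness of Fourier coefficients\<close>

text \<open>The character appears without conjugation: \<open>freqs_on S\<close> is closed under
  negation, so this is the usual vanishing of all Fourier coefficients. Integrability is bundled in
  so that inductions carry it along.\<close>

definition null_coeffs :: "nat set \<Rightarrow> ((nat \<Rightarrow> real) \<Rightarrow> complex) \<Rightarrow> bool" where
  "null_coeffs S G \<longleftrightarrow> integrable (cube_measure S) G \<and>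
     (\<forall>k\<in>freqs_on S. (\<integral>b. G b * torus_char S k b \<partial>cube_measure S) = 0)"

lemma integrable_mult_torus_char:
  assumes "integrable (cube_measure S) G"
  shows "integrable (cube_measure S) (\<lambda>b. G b * torus_char S k b)"
  by (rule Bochner_Integration.integrable_bound[OF assms])
     (use assms in \<open>auto simp: norm_mult\<close>)

lemma freqs_on_add:
  assumes "k \<in> freqs_on S" "l \<in> freqs_on S"
  shows "(\<lambda>i. k i + l i) \<in> freqs_on S"
proof -
  have "{i. k i + l i \<noteq> 0} \<subseteq> {i. k i \<noteq> 0} \<union> {i. l i \<noteq> 0}" by auto
  then show ?thesis using assms by (auto simp: freqs_on_def freqs_def intro: finite_subset)
qed

lemma freqs_on_minus: "k \<in> freqs_on S \<Longrightarrow> (\<lambda>i. - k i) \<in> freqs_on S"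
  by (auto simp: freqs_on_def freqs_def)

lemma freqs_on_zero: "(\<lambda>_. 0) \<in> freqs_on S"
  by (auto simp: freqs_on_def freqs_def)

lemma freqs_on_single: "i \<in> S \<Longrightarrow> (\<lambda>j. if j = i then m else 0) \<in> freqs_on S"
  by (auto simp: freqs_on_def freqs_def)

section \<open>Multiplication by trigonometric peaks\<close>

text \<open>Squaring doubles the angle \<open>pi * (b i - c)\<close>, which makes the frequencies
  the integers 0, 1 and -1. The centre \<open>c\<close> enters only through the phases of the
  coefficients.\<close>

lemma cos_squared_eq_torus_char:
  assumes "finite S" "i \<in> S"
  shows "complex_of_real ((cos (pi * (b i - c)))\<^sup>2) =
    1/2 + cis (- 2 * pi * c) / 4 * torus_char S (\<lambda>j. if j = i then 1 else 0) b
        + cis (2 * pi * c) / 4 * torus_char S (\<lambda>j. if j = i then - 1 else 0) b"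
proof -
  have char_single: "torus_char S (\<lambda>j. if j = i then m else 0) b = cis (2 * pi * m * b i)" for m :: int
    using assms by (simp add: torus_char_def if_distrib[of of_int] if_distrib[of "\<lambda>x. x * _"] sum.delta
        mult.assoc cong: if_cong)
  have "complex_of_real ((cos (pi * (b i - c)))\<^sup>2) = of_real ((1 + cos (2 * (pi * (b i - c)))) / 2)"
    by (simp add: cos_double_cos)
  also have "\<dots> = 1/2 + (cis (2 * pi * (b i - c)) + cis (- (2 * pi * (b i - c)))) / 4"
    by (simp add: complex_eq_iff mult.assoc)
  also have "cis (2 * pi * (b i - c)) = cis (- 2 * pi * c) * torus_char S (\<lambda>j. if j = i then 1 else 0) b"
    by (simp only: char_single cis_mult) (simp add: algebra_simps)
  also have "cis (- (2 * pi * (b i - c))) = cis (2 * pi * c) * torus_char S (\<lambda>j. if j = i then - 1 else 0) b"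
    by (simp only: char_single cis_mult) (simp add: algebra_simps)
  finally show ?thesis by (simp add: algebra_simps)
qed

lemma null_coeffs_mult_cos_squared:
  assumes "finite S" "i \<in> S" "null_coeffs S G"
  shows "null_coeffs S (\<lambda>b. G b * of_real ((cos (pi * (b i - c)))\<^sup>2))"
proof -
  define e where "e m = (\<lambda>j. if j = i then m else (0::int))" for m
  have e: "e m \<in> freqs_on S" for m
    using assms(2) by (auto simp: e_def freqs_on_single)
  have G: "integrable (cube_measure S) G"
    and G0: "\<And>k. k \<in> freqs_on S \<Longrightarrow> (\<integral>b. G b * torus_char S k b \<partial>cube_measure S) = 0"
    using assms(3) by (auto simp: null_coeffs_def)
  \<comment> \<open>By the double-angle formula the factor only combines each coefficient with its two neighbours.\<close>
  have eq: "G b * of_real ((cos (pi * (b i - c)))\<^sup>2) = 1/2 * G b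
      + cis (- 2 * pi * c) / 4 * (G b * torus_char S (e 1) b)
      + cis (2 * pi * c) / 4 * (G b * torus_char S (e (- 1)) b)" for b
    unfolding cos_squared_eq_torus_char[OF assms(1,2)] e_def by (simp add: algebra_simps)
  have eqk: "G b * of_real ((cos (pi * (b i - c)))\<^sup>2) * torus_char S k b = 1/2 * (G b * torus_char S k b)
      + cis (- 2 * pi * c) / 4 * (G b * torus_char S (\<lambda>j. e 1 j + k j) b)
      + cis (2 * pi * c) / 4 * (G b * torus_char S (\<lambda>j. e (- 1) j + k j) b)" for b k
    unfolding eq torus_char_mult[symmetric] by (simp add: algebra_simps)
  note [simp] = integrable_mult_torus_char[OF G] G
  show ?thesis
    unfolding null_coeffs_def
  proof (intro conjI ballI)
    show "integrable (cube_measure S) (\<lambda>b. G b * of_real ((cos (pi * (b i - c)))\<^sup>2))"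
      unfolding eq by simp
    fix k assume k: "k \<in> freqs_on S"
    show "(\<integral>b. G b * of_real ((cos (pi * (b i - c)))\<^sup>2) * torus_char S k b \<partial>cube_measure S) = 0"
      unfolding eqk by (simp add: G0 k e freqs_on_add)
  qed
qed

lemma null_coeffs_mult_peak:
  assumes "finite S" "null_coeffs S G"
  shows "null_coeffs S (\<lambda>b. G b * of_real ((\<Prod>i\<in>S. (cos (pi * (b i - y i)))\<^sup>2) ^ n))"
proof -
  \<comment> \<open>\<open>H\<close> is arbitrary because the induction on \<open>n\<close> below
    applies this to \<open>G\<close> already multiplied by the \<open>n\<close>-th power of the
    peak.\<close>
  have step: "null_coeffs S (\<lambda>b. H b * of_real (\<Prod>i\<in>I. (cos (pi * (b i - y i)))\<^sup>2))"
    if H: "null_coeffs S H" and "finite I" "I \<subseteq> S" for I H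
    using that(2,3)
  proof (induction I rule: finite_induct)
    case (insert i I)
    then have "null_coeffs S (\<lambda>b. H b * of_real (\<Prod>i\<in>I. (cos (pi * (b i - y i)))\<^sup>2)
        * of_real ((cos (pi * (b i - y i)))\<^sup>2))"
      by (intro null_coeffs_mult_cos_squared) (auto simp: assms)
    with insert show ?case by (simp add: mult_ac)
  qed (use H in simp)
  show ?thesis
  proof (induction n)
    case (Suc n)
    from step[OF Suc assms(1) order_refl] show ?case by (simp add: mult_ac)
  qed (use assms in simp)
qed

section \<open>Concentration of the peaks\<close>

text \<open>Turns continuity in the product topology into a box in the coordinates of
  \<open>S\<close>. Without such a box there are points with \<open>h \<le> a\<close> whose
  coordinates in \<open>S\<close> tend to those of \<open>y\<close>; the other coordinates are all
  \<open>undefined\<close>, so these points converge to \<open>y\<close> and force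
  \<open>h y \<le> a\<close>.\<close>

lemma continuous_on_cube_ball:
  fixes h :: "(nat \<Rightarrow> real) \<Rightarrow> real"
  assumes "continuous_on (cube S) h" "y \<in> cube S" "h y > a"
  obtains d where "d > 0" "\<And>x. x \<in> cube S \<Longrightarrow> (\<And>i. i \<in> S \<Longrightarrow> \<bar>x i - y i\<bar> < d) \<Longrightarrow> h x > a"
proof (rule ccontr)
  note witness = that
  assume "\<not> thesis"
  have "\<exists>x\<in>cube S. (\<forall>i\<in>S. \<bar>x i - y i\<bar> < d) \<and> h x \<le> a" if d: "d > 0" for d
  proof (rule ccontr)
    assume "\<not> (\<exists>x\<in>cube S. (\<forall>i\<in>S. \<bar>x i - y i\<bar> < d) \<and> h x \<le> a)"
    then have "thesis" by (intro witness[OF d]) (auto simp: not_le)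
    with \<open>\<not> thesis\<close> show False by contradiction
  qed
  then have "\<forall>m. \<exists>x. x \<in> cube S \<and> (\<forall>i\<in>S. \<bar>x i - y i\<bar> < inverse (real (Suc m))) \<and> h x \<le> a"
    by (metis inverse_positive_iff_positive of_nat_0_less_iff zero_less_Suc)
  then obtain x where x: "\<And>m. x m \<in> cube S" "\<And>m. h (x m) \<le> a"
      "\<And>m i. i \<in> S \<Longrightarrow> \<bar>x m i - y i\<bar> < inverse (real (Suc m))"
    by metis
  have "(\<lambda>m. x m i) \<longlonglongrightarrow> y i" for i
  proof (cases "i \<in> S")
    case True
    show ?thesis
      by (rule metric_tendsto_imp_tendsto[OF LIMSEQ_inverse_real_of_nat])
         (use x(3)[OF True] in \<open>auto simp: dist_real_def intro!: always_eventually less_imp_le\<close>)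
  next
    case False
    then show ?thesis using x(1) assms(2) by (auto simp: cube_def PiE_iff extensional_def)
  qed
  then have "limitin euclidean x y sequentially"
    by (simp add: euclidean_product_topology[symmetric] limitin_componentwise)
  then have "x \<longlonglongrightarrow> y" by simp
  then have "(\<lambda>m. h (x m)) \<longlonglongrightarrow> h y"
    using assms x(1) unfolding continuous_on_sequentially by (auto simp: o_def)
  then have "h y \<le> a" by (rule LIMSEQ_le_const2) (use x in auto)
  with assms show False by simp
qed

lemma cos_power2_ge:
  assumes "\<bar>t\<bar> \<le> e" "e \<le> 1/2"
  shows "(cos (pi * t))\<^sup>2 \<ge> (cos (pi * e))\<^sup>2"
proof -
  have "cos (pi * e) \<le> cos (pi * \<bar>t\<bar>)"
    using assms by (intro cos_monotone_0_pi_le) (auto intro: mult_left_mono)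
  moreover have "0 \<le> cos (pi * e)"
    using assms by (intro cos_ge_zero) (auto intro: order_trans[of _ 0])
  moreover have "cos (pi * \<bar>t\<bar>) = cos (pi * t)"
    by (cases "t \<ge> 0") auto
  ultimately show ?thesis by (simp add: power_mono)
qed

text \<open>The bound \<open>1 - d\<close> keeps \<open>t\<close> away from the next peaks at 1 and
  -1. Beyond 1/2 the cosine is negative, but the reflection
  \<open>cos (pi * (1 - d)) = - cos (pi * d)\<close> still bounds its absolute value.\<close>

lemma cos_power2_le:
  assumes "d \<le> \<bar>t\<bar>" "\<bar>t\<bar> \<le> 1 - d" "0 \<le> d"
  shows "(cos (pi * t))\<^sup>2 \<le> (cos (pi * d))\<^sup>2"
proof -
  have "cos (pi * \<bar>t\<bar>) \<le> cos (pi * d)"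
    using assms by (intro cos_monotone_0_pi_le) (auto intro: mult_left_mono)
  moreover have "cos (pi * (1 - d)) \<le> cos (pi * \<bar>t\<bar>)"
    using assms by (intro cos_monotone_0_pi_le) (auto intro: mult_left_mono)
  moreover have "cos (pi * (1 - d)) = - cos (pi * d)"
    by (simp add: right_diff_distrib cos_diff)
  moreover have "cos (pi * \<bar>t\<bar>) = cos (pi * t)"
    by (cases "t \<ge> 0") auto
  ultimately show ?thesis by (simp add: abs_le_square_iff[symmetric])
qed

text \<open>If all these integrals vanished, the positive contribution of a small box around
  \<open>y\<close> would be bounded by that of the far region, although the latter decays at a
  strictly faster geometric rate.\<close>

lemma integral_mult_peak_nonzero:
  fixes h :: "(nat \<Rightarrow> real) \<Rightarrow> real"
  assumes "finite S" "integrable (cube_measure S) h" "continuous_on (cube S) h"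
    and y: "y \<in> cube S" "h y > 0"
  shows "\<exists>n. (\<integral>x. h x * (\<Prod>i\<in>S. (cos (pi * (x i - y i)))\<^sup>2) ^ n \<partial>cube_measure S) \<noteq> 0"
proof (rule ccontr)
  define T where "T x = (\<Prod>i\<in>S. (cos (pi * (x i - y i)))\<^sup>2)" for x :: "nat \<Rightarrow> real"
  assume "\<not> ?thesis"
  then have zero: "(\<integral>x. h x * T x ^ n \<partial>cube_measure S) = 0" for n
    by (auto simp: T_def)
  interpret finite_measure "cube_measure S"
    by (rule finite_measure_cube_measure) fact
  have yi: "\<bar>y i\<bar> < 1/2" if "i \<in> S" for i
    using y(1) that by (auto simp: cube_def PiE_iff)
  have "h y > h y / 2" using y(2) by simp
  from continuous_on_cube_ball[OF assms(3) y(1) this] obtain d0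
    where d0: "d0 > 0" "\<And>x. x \<in> cube S \<Longrightarrow> (\<And>i. i \<in> S \<Longrightarrow> \<bar>x i - y i\<bar> < d0) \<Longrightarrow> h x > h y / 2"
    by metis
  \<comment> \<open>A \<open>d\<close>-margin around \<open>y\<close> inside the cube keeps \<open>x i - y i\<close> away from \<open>\<plusminus>1\<close>,
    where \<open>cos\<^sup>2\<close> would peak again.\<close>
  define d where "d = Min (insert (1/2) (insert d0 ((\<lambda>i. 1/2 - \<bar>y i\<bar>) ` S)))"
  have "0 < d"
    using \<open>finite S\<close> d0(1) yi unfolding d_def by (subst Min_gr_iff) auto
  moreover have "d \<le> t" if "t \<in> insert (1/2) (insert d0 ((\<lambda>i. 1/2 - \<bar>y i\<bar>) ` S))" for t
    using \<open>finite S\<close> that unfolding d_def by (intro Min_le) auto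
  ultimately have d: "0 < d" "d \<le> 1/2" "d \<le> d0" "\<And>i. i \<in> S \<Longrightarrow> d \<le> 1/2 - \<bar>y i\<bar>"
    by blast+
  define q where "q = (cos (pi * d))\<^sup>2"
  \<comment> \<open>Two radii are needed. Outside radius \<open>d\<close> a single factor of
    \<open>T\<close> is known to be small, giving the bound \<open>q\<close>. Inside radius
    \<open>t\<close> all \<open>card S\<close> factors may drop to
    \<open>(cos (pi * t))\<^sup>2\<close> together, giving only the bound \<open>c t\<close>. As
    \<open>c t\<close> tends to 1 at 0 while \<open>q < 1\<close>, a smaller radius \<open>e\<close>
    achieves \<open>c e > q\<close>.\<close>
  define c where "c t = ((cos (pi * t))\<^sup>2) ^ card S" for t :: real
  have "0 \<le> cos (pi * d)"
    using d by (auto intro!: cos_ge_zero intro: order_trans[of _ 0])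
  moreover have "cos (pi * d) < cos 0"
    using d by (intro cos_monotone_0_pi) auto
  ultimately have q: "0 \<le> q" "q < 1"
    by (auto simp: q_def power_less_one_iff)
  have "(c \<longlongrightarrow> 1) (at_right 0)"
    unfolding c_def by (auto intro!: tendsto_eq_intros)
  then have "eventually (\<lambda>t. c t > q) (at_right 0)"
    using q(2) by (rule order_tendstoD)
  moreover have "eventually (\<lambda>t. t \<in> {0<..<d}) (at_right 0)"
    using d(1) by (rule eventually_at_right_real)
  ultimately have "eventually (\<lambda>t. c t > q \<and> t \<in> {0<..<d}) (at_right 0)"
    by (rule eventually_conj)
  then obtain e where e: "c e > q" "0 < e" "e < d"
    using eventually_happens'[OF trivial_limit_at_right_real] by auto
  have T: "0 \<le> T x" "T x \<le> 1" for x
    unfolding T_def by (auto intro!: prod_nonneg prod_le_1 simp: abs_square_le_1)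
  have T_in: "T x \<ge> c e" if "\<And>i. i \<in> S \<Longrightarrow> \<bar>x i - y i\<bar> < e" for x
  proof -
    have "(\<Prod>i\<in>S. (cos (pi * e))\<^sup>2) \<le> T x"
      unfolding T_def using that d(2) e(3)
      by (intro prod_mono conjI cos_power2_ge) (auto intro: less_imp_le)
    then show ?thesis by (simp add: c_def)
  qed
  have T_out: "T x \<le> q" if x: "x \<in> cube S" and i: "i \<in> S" "\<bar>x i - y i\<bar> \<ge> d" for x i
  proof -
    have "\<bar>x i - y i\<bar> \<le> 1 - d"
      using x i(1) d(4)[OF i(1)] by (auto simp: cube_def PiE_iff)
    then have "(cos (pi * (x i - y i)))\<^sup>2 \<le> q"
      unfolding q_def using i(2) d(1) by (intro cos_power2_le) auto
    moreover have "T x = (cos (pi * (x i - y i)))\<^sup>2 * (\<Prod>j\<in>S - {i}. (cos (pi * (x j - y j)))\<^sup>2)"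
      unfolding T_def by (rule prod.remove) fact+
    moreover have "(\<Prod>j\<in>S - {i}. (cos (pi * (x j - y j)))\<^sup>2) \<le> 1"
      by (intro prod_le_1) (auto simp: abs_square_le_1)
    ultimately show ?thesis
      by (smt (verit) mult_left_le zero_le_power2)
  qed
  define B where "B = (\<Pi>\<^sub>E i\<in>S. {y i - e<..<y i + e})"
  have B_iff: "x \<in> B \<longleftrightarrow> (\<forall>i\<in>S. \<bar>x i - y i\<bar> < e)" if "x \<in> cube S" for x
    using that by (auto simp: B_def cube_def PiE_iff abs_less_iff)
  have B_sub: "B \<subseteq> cube S"
  proof -
    have "{y i - e<..<y i + e} \<subseteq> {- 1/2<..<1/2}" if "i \<in> S" for i
      using d(4)[OF that] e by auto
    then show ?thesis unfolding B_def cube_def by (intro PiE_mono)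
  qed
  have eB: "emeasure (cube_measure S) B = ennreal ((2 * e) ^ card S)"
    using B_sub e \<open>finite S\<close> unfolding B_def
    by (subst emeasure_cube_measure_PiE) (auto simp: prod_constant ennreal_power)
  then have mB: "measure (cube_measure S) B = (2 * e) ^ card S"
    using e by (simp add: measure_def)
  have B_sets [measurable]: "B \<in> sets (cube_measure S)"
    using B_sub cube_sets[OF \<open>finite S\<close>] \<open>finite S\<close>
    unfolding cube_measure_def B_def
    by (subst sets_restrict_space_iff) (auto simp: cube_Int_space intro!: sets_PiM_I_finite)
  have B_int: "integrable (cube_measure S) (indicator B :: _ \<Rightarrow> real)"
    by (intro integrable_real_indicator) (auto simp: eB)
  define K where "K = (\<integral>x. \<bar>h x\<bar> \<partial>cube_measure S)"
  have T_meas [measurable]: "T \<in> borel_measurable (cube_measure S)"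
  proof (rule continuous_on_cube_measurable)
    have "continuous_on (cube S) (\<lambda>b. b i)" for i
      by (rule continuous_on_subset[OF continuous_on_product_coordinates]) auto
    then show "continuous_on (cube S) T"
      unfolding T_def[abs_def] by (intro continuous_intros)
  qed
  have ineq: "h y / 2 * c e ^ n * (2 * e) ^ card S \<le> q ^ n * K" for n
  proof -
    have int: "integrable (cube_measure S) (\<lambda>x. h x * T x ^ n)"
      by (rule Bochner_Integration.integrable_bound[OF assms(2)])
         (use assms(2) T in \<open>auto simp: abs_mult intro!: mult_left_le power_le_one\<close>)
    \<comment> \<open>The far bound is subtracted on the whole cube instead of the far region alone:
      the minorant only gets smaller, and its integral is explicit in \<open>K\<close>.\<close>
    have "(\<integral>x. h y / 2 * c e ^ n * indicator B x - q ^ n * \<bar>h x\<bar> \<partial>cube_measure S)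
        \<le> (\<integral>x. h x * T x ^ n \<partial>cube_measure S)"
    proof (rule integral_mono[OF _ int])
      show "integrable (cube_measure S) (\<lambda>x. h y / 2 * c e ^ n * indicator B x - q ^ n * \<bar>h x\<bar>)"
        using assms(2) B_int by (intro Bochner_Integration.integrable_diff integrable_mult_right) auto
      fix x assume "x \<in> space (cube_measure S)"
      then have x: "x \<in> cube S" by (simp add: space_cube_measure)
      consider "x \<in> B" | "x \<notin> B" "\<And>i. i \<in> S \<Longrightarrow> \<bar>x i - y i\<bar> < d"
        | i where "x \<notin> B" "i \<in> S" "\<bar>x i - y i\<bar> \<ge> d"
        by (meson not_less)
      then show "h y / 2 * c e ^ n * indicator B x - q ^ n * \<bar>h x\<bar> \<le> h x * T x ^ n"
      proof cases
        case 1
        then have close: "\<bar>x i - y i\<bar> < e" if "i \<in> S" for i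
          using B_iff[OF x] that by auto
        then have "\<bar>x i - y i\<bar> < d0" if "i \<in> S" for i
          using e(3) d(3) that by force
        then have "h y / 2 < h x" by (rule d0(2)[OF x])
        moreover have "c e \<le> T x" using close by (rule T_in)
        ultimately have "h y / 2 * c e ^ n \<le> h x * T x ^ n"
          using y(2) e(1) q(1) by (intro mult_mono power_mono) auto
        moreover have "0 \<le> q ^ n * \<bar>h x\<bar>" using q by simp
        ultimately show ?thesis using 1 by simp
      next
        case 2
        then have "h y / 2 < h x"
          using d(3) by (intro d0(2)[OF x]) force
        then have "0 \<le> h x * T x ^ n" using T y(2) by simp
        moreover have "0 \<le> q ^ n * \<bar>h x\<bar>" using q by simp
        ultimately show ?thesis using 2 by simp
      next
        case 3
        have "\<bar>h x * T x ^ n\<bar> \<le> q ^ n * \<bar>h x\<bar>"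
          using T_out[OF x 3(2,3)] T(1)[of x] by (simp add: abs_mult mult.commute mult_left_mono power_mono)
        with 3 show ?thesis by simp
      qed
    qed
    also have "\<dots> = 0" by (rule zero)
    also have "(\<integral>x. h y / 2 * c e ^ n * indicator B x - q ^ n * \<bar>h x\<bar> \<partial>cube_measure S)
        = h y / 2 * c e ^ n * (2 * e) ^ card S - q ^ n * K"
      using assms(2) B_int B_sub by (simp add: K_def mB space_cube_measure Int_absorb2)
    finally show ?thesis by simp
  qed
  have ce: "0 < c e" using e(1) q(1) by linarith
  \<comment> \<open>Dividing by \<open>c e ^ n\<close> leaves a fixed positive left side against
    powers of a ratio below 1.\<close>
  have "h y / 2 * (2 * e) ^ card S \<le> (q / c e) ^ n * K" for n
    using ineq[of n] ce by (simp add: power_divide field_simps)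
  moreover have lim: "(\<lambda>n. (q / c e) ^ n * K) \<longlonglongrightarrow> 0 * K"
    using ce e(1) q(1) by (intro tendsto_mult_right LIMSEQ_power_zero) auto
  ultimately have "h y / 2 * (2 * e) ^ card S \<le> 0 * K"
    by (intro LIMSEQ_le_const[OF lim]) blast
  moreover have "0 < h y / 2 * (2 * e) ^ card S" using y(2) e(2) by simp
  ultimately show False by simp
qed

text \<open>Multiplying \<open>G\<close> by a peak keeps all coefficients zero, and the one at
  frequency 0 is the plain integral that the peak argument shows to be nonzero.\<close>

lemma null_coeffs_imp_zero:
  assumes "finite S" "null_coeffs S G" "continuous_on (cube S) G" "y \<in> cube S"
  shows "G y = 0"
proof (rule ccontr)
  assume "G y \<noteq> 0"
  \<comment> \<open>The factor \<open>cnj (G y)\<close> rotates the value at \<open>y\<close> onto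
    the positive real axis, reducing the complex case to a real function with
    \<open>h y > 0\<close>.\<close>
  define h where "h x = Re (cnj (G y) * G x)" for x
  have int: "integrable (cube_measure S) G"
    using assms(2) by (simp add: null_coeffs_def)
  have h_int: "integrable (cube_measure S) h"
    unfolding h_def[abs_def] using int by (intro integrable_Re integrable_mult_right) auto
  have h_cont: "continuous_on (cube S) h"
    unfolding h_def[abs_def] by (intro continuous_intros assms)
  have "h y = (cmod (G y))\<^sup>2"
    by (simp add: h_def complex_norm_square[symmetric] mult.commute)
  then have "h y > 0" using \<open>G y \<noteq> 0\<close> by simp
  from integral_mult_peak_nonzero[OF assms(1) h_int h_cont assms(4) this] obtain n where
    n: "(\<integral>x. h x * (\<Prod>i\<in>S. (cos (pi * (x i - y i)))\<^sup>2) ^ n \<partial>cube_measure S) \<noteq> 0" ..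
  define T where "T x = (\<Prod>i\<in>S. (cos (pi * (x i - y i)))\<^sup>2) ^ n" for x :: "nat \<Rightarrow> real"
  have "null_coeffs S (\<lambda>x. G x * of_real (T x))"
    unfolding T_def by (rule null_coeffs_mult_peak) fact+
  then have 1: "integrable (cube_measure S) (\<lambda>x. G x * of_real (T x))"
    and "(\<integral>x. G x * of_real (T x) * torus_char S (\<lambda>_. 0) x \<partial>cube_measure S) = 0"
    using freqs_on_zero unfolding null_coeffs_def by blast+
  then have 2: "(\<integral>x. G x * of_real (T x) \<partial>cube_measure S) = 0"
    by (simp add: torus_char_zero)
  have "(\<integral>x. h x * T x \<partial>cube_measure S) = (\<integral>x. Re (cnj (G y) * (G x * of_real (T x))) \<partial>cube_measure S)"
    by (simp add: h_def algebra_simps)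
  also have "\<dots> = Re (\<integral>x. cnj (G y) * (G x * of_real (T x)) \<partial>cube_measure S)"
    using 1 by (intro integral_Re) auto
  also have "\<dots> = 0" using 2 by simp
  finally show False using n by (simp add: T_def)
qed

section \<open>Pointwise Fourier expansion on the cube\<close>

text \<open>Summability of the norms gives uniform convergence by the Weierstrass test, so the sum
  \<open>s\<close> of the series is continuous and bounded. It has the same coefficients as
  \<open>F\<close>, and uniqueness applies to \<open>F - s\<close>.\<close>

lemma fourier_series_has_sum:
  assumes S: "finite S" and F: "continuous_on (cube S) F" "integrable (cube_measure S) F"
    and a: "\<And>k. a k = (\<integral>b. F b * torus_char S (\<lambda>i. - k i) b \<partial>cube_measure S)"
    and summable: "(\<lambda>k. norm (a k)) summable_on freqs_on S"
    and y: "y \<in> cube S"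
  shows "((\<lambda>k. a k * torus_char S k y) has_sum F y) (freqs_on S)"
proof -
  define s where "s b = (\<Sum>\<^sub>\<infinity>k\<in>freqs_on S. a k * torus_char S k b)" for b
  define p where "p X b = (\<Sum>k\<in>X. a k * torus_char S k b)" for X b
  interpret finite_measure "cube_measure S"
    by (rule finite_measure_cube_measure) fact
  have char_int: "integrable (cube_measure S) (torus_char S k)" for k
    by (rule integrable_const_bound[of _ 1]) auto
  have ul: "uniform_limit UNIV p s (finite_subsets_at_top (freqs_on S))"
    unfolding p_def s_def
    by (rule Weierstrass_m_test_general[where M = "\<lambda>k. norm (a k)"])
       (use summable in \<open>auto simp: norm_mult\<close>)
  have abs_summable: "(\<lambda>k. norm (a k * torus_char S k b)) summable_on freqs_on S" for b
    using summable by (simp add: norm_mult)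
  have s_cont: "continuous_on (cube S) s"
    by (rule uniform_limit_theorem[OF _ uniform_limit_on_subset[OF ul]])
       (auto simp: p_def[abs_def] intro!: always_eventually continuous_intros)
  have s_int: "integrable (cube_measure S) s"
  proof (rule integrable_const_bound)
    have "norm (s b) \<le> (\<Sum>\<^sub>\<infinity>k\<in>freqs_on S. norm (a k))" for b
      using norm_infsum_bound[OF abs_summable[of b]] by (simp add: s_def norm_mult)
    then show "AE b in cube_measure S. norm (s b) \<le> (\<Sum>\<^sub>\<infinity>k\<in>freqs_on S. norm (a k))"
      by simp
  qed (rule continuous_on_cube_measurable[OF s_cont])
  \<comment> \<open>Integration against the character of \<open>m\<close> isolates the term of
    frequency \<open>- m\<close>, whence the sign.\<close>
  have s_coeff: "(\<integral>b. s b * torus_char S m b \<partial>cube_measure S) = a (\<lambda>i. - m i)"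
    if m: "m \<in> freqs_on S" for m
  proof -
    \<comment> \<open>A finite partial sum \<open>p X\<close> within \<open>e\<close> of
      \<open>s\<close> everywhere and with \<open>- m\<close> in \<open>X\<close> has, by
      orthogonality, exactly the coefficient \<open>a (\<lambda>i. - m i)\<close>. The cube has
      measure 1, so replacing \<open>s\<close> by \<open>p X\<close> costs at most
      \<open>e\<close>.\<close>
    have "norm ((\<integral>b. s b * torus_char S m b \<partial>cube_measure S) - a (\<lambda>i. - m i)) \<le> e" if "e > 0" for e :: real
    proof -
      have "eventually (\<lambda>X. \<forall>b\<in>UNIV. dist (p X b) (s b) < e) (finite_subsets_at_top (freqs_on S))"
        using ul that by (rule uniform_limitD)
      moreover have "eventually (\<lambda>X. finite X \<and> {\<lambda>i. - m i} \<subseteq> X \<and> X \<subseteq> freqs_on S)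
          (finite_subsets_at_top (freqs_on S))"
        using freqs_on_minus[OF m] by (auto simp: eventually_finite_subsets_at_top)
      ultimately have "eventually (\<lambda>X. (\<forall>b\<in>UNIV. dist (p X b) (s b) < e) \<and>
          finite X \<and> {\<lambda>i. - m i} \<subseteq> X \<and> X \<subseteq> freqs_on S) (finite_subsets_at_top (freqs_on S))"
        by (rule eventually_conj)
      from eventually_happens'[OF finite_subsets_at_top_neq_bot this] obtain X
        where X: "\<And>b. dist (p X b) (s b) < e" "finite X" "(\<lambda>i. - m i) \<in> X" "X \<subseteq> freqs_on S"
        by auto
      have eq: "p X b * torus_char S m b = (\<Sum>k\<in>X. a k * torus_char S (\<lambda>i. k i + m i) b)" for b
        by (simp add: p_def sum_distrib_right mult.assoc torus_char_mult)
      have p_int: "integrable (cube_measure S) (\<lambda>b. p X b * torus_char S m b)"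
        unfolding eq by (intro Bochner_Integration.integrable_sum integrable_mult_right char_int)
      have "(\<integral>b. p X b * torus_char S m b \<partial>cube_measure S)
          = (\<Sum>k\<in>X. a k * (\<integral>b. torus_char S (\<lambda>i. k i + m i) b \<partial>cube_measure S))"
        unfolding eq using char_int by (subst Bochner_Integration.integral_sum) auto
      also have "\<dots> = (\<Sum>k\<in>X. if k = (\<lambda>i. - m i) then a k else 0)"
      proof (rule sum.cong[OF refl])
        fix k assume "k \<in> X"
        then have "(\<lambda>i. k i + m i) \<in> freqs_on S"
          using X(4) m by (auto intro: freqs_on_add)
        moreover have "(\<lambda>i. k i + m i) = (\<lambda>_. 0) \<longleftrightarrow> k = (\<lambda>i. - m i)"
          by (auto simp: fun_eq_iff eq_neg_iff_add_eq_0)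
        ultimately show "a k * (\<integral>b. torus_char S (\<lambda>i. k i + m i) b \<partial>cube_measure S)
            = (if k = (\<lambda>i. - m i) then a k else 0)"
          using integral_torus_char[OF S] by simp
      qed
      also have "\<dots> = a (\<lambda>i. - m i)"
        using X(2,3) by (simp add: sum.delta)
      finally have p_coeff: "(\<integral>b. p X b * torus_char S m b \<partial>cube_measure S) = a (\<lambda>i. - m i)" .
      have "(\<integral>b. s b * torus_char S m b \<partial>cube_measure S) - a (\<lambda>i. - m i)
          = (\<integral>b. s b * torus_char S m b - p X b * torus_char S m b \<partial>cube_measure S)"
        unfolding p_coeff[symmetric] using p_int integrable_mult_torus_char[OF s_int] by simp
      also have "norm \<dots> \<le> (\<integral>b. norm (s b * torus_char S m b - p X b * torus_char S m b) \<partial>cube_measure S)"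
        by simp
      also have "\<dots> \<le> (\<integral>b. e \<partial>cube_measure S)"
      proof (rule integral_mono)
        show "norm (s b * torus_char S m b - p X b * torus_char S m b) \<le> e" for b
          using X(1)[of b]
          by (simp add: left_diff_distrib[symmetric] norm_mult dist_norm norm_minus_commute)
      qed (use p_int integrable_mult_torus_char[OF s_int] in auto)
      also have "\<dots> = e"
        using emeasure_cube[OF S] by (simp add: space_cube_measure measure_def)
      finally show ?thesis .
    qed
    then have "norm ((\<integral>b. s b * torus_char S m b \<partial>cube_measure S) - a (\<lambda>i. - m i)) \<le> 0"
      by (rule field_le_epsilon) auto
    then show ?thesis by simp
  qed
  have "null_coeffs S (\<lambda>b. F b - s b)"
    unfolding null_coeffs_def
    using F(2) s_int integrable_mult_torus_char[OF F(2)] integrable_mult_torus_char[OF s_int]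
    by (auto simp: left_diff_distrib s_coeff a)
  then have "F y - s y = 0"
    by (rule null_coeffs_imp_zero[OF S _ _ y]) (intro continuous_intros F s_cont)
  then have "F y = (\<Sum>\<^sub>\<infinity>k\<in>freqs_on S. a k * torus_char S k y)"
    by (simp add: s_def)
  then show ?thesis
    using has_sum_infsum[OF Infinite_Sum.abs_summable_summable[OF abs_summable[of y]]] by simp
qed

section \<open>Summation over all components\<close>

text \<open>An infinite sum in \<open>ennreal\<close> is the supremum of its finite partial sums; if
  it is finite, it bounds the real partial sums, and nonnegative terms with bounded partial sums are
  summable.\<close>

lemma infsum_ennreal_finite:
  fixes g :: "'a \<Rightarrow> real"
  assumes nonneg: "\<And>x. x \<in> A \<Longrightarrow> 0 \<le> g x"
    and finite: "(\<Sum>\<^sub>\<infinity>x\<in>A. ennreal (g x)) < \<infinity>"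
  shows "g summable_on A" "(\<Sum>\<^sub>\<infinity>x\<in>A. ennreal (g x)) = ennreal (infsum g A)"
proof -
  have le: "ennreal (sum g X) \<le> (\<Sum>\<^sub>\<infinity>x\<in>A. ennreal (g x))" if "X \<subseteq> A" "finite X" for X
  proof -
    have "ennreal (sum g X) = (\<Sum>x\<in>X. ennreal (g x))"
      using that nonneg by (intro sum_ennreal[symmetric]) auto
    also have "\<dots> \<le> (\<Sum>\<^sub>\<infinity>x\<in>A. ennreal (g x))"
      using that by (subst nonneg_infsum_complete) (auto intro!: SUP_upper)
    finally show ?thesis .
  qed
  have "bdd_above (sum g ` {X. X \<subseteq> A \<and> finite X})"
  proof (rule bdd_aboveI2)
    fix X assume "X \<in> {X. X \<subseteq> A \<and> finite X}"
    then have "enn2real (ennreal (sum g X)) \<le> enn2real (\<Sum>\<^sub>\<infinity>x\<in>A. ennreal (g x))"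
      using finite by (intro enn2real_mono le) (auto simp: top.not_eq_extremum)
    moreover have "0 \<le> sum g X"
      using \<open>X \<in> _\<close> nonneg by (intro sum_nonneg) auto
    ultimately show "sum g X \<le> enn2real (\<Sum>\<^sub>\<infinity>x\<in>A. ennreal (g x))" by simp
  qed
  with nonneg show "g summable_on A"
    by (rule nonneg_bdd_above_summable_on)
  then have "ennreal (infsum g A) = (SUP X\<in>{X. finite X \<and> X \<subseteq> A}. ennreal (sum g X))"
    using nonneg by (rule infsum_nonneg_is_SUPREMUM_ennreal)
  also have "\<dots> = (SUP X\<in>{X. finite X \<and> X \<subseteq> A}. \<Sum>x\<in>X. ennreal (g x))"
    using nonneg by (intro SUP_cong refl sum_ennreal[symmetric]) auto
  also have "\<dots> = (\<Sum>\<^sub>\<infinity>x\<in>A. ennreal (g x))"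
    by (rule nonneg_infsum_complete[symmetric]) auto
  finally show "(\<Sum>\<^sub>\<infinity>x\<in>A. ennreal (g x)) = ennreal (infsum g A)" ..
qed

text \<open>Tonelli for sums. Each inner sum is dominated by the outer one, as a partial sum over a
  singleton, hence finite; so the inner sums and then the outer sum pass to the reals.\<close>

lemma norm_summable_on_Sigma_ennrealI:
  fixes c :: "'a \<Rightarrow> 'b \<Rightarrow> 'c::real_normed_vector"
  assumes "(\<Sum>\<^sub>\<infinity>x\<in>A. \<Sum>\<^sub>\<infinity>y\<in>B x. ennreal (norm (c x y))) < \<infinity>"
  shows "(\<lambda>(x, y). norm (c x y)) summable_on Sigma A B"
proof -
  define I where "I x = (\<Sum>\<^sub>\<infinity>y\<in>B x. ennreal (norm (c x y)))" for x
  have "I x \<le> (\<Sum>\<^sub>\<infinity>x\<in>A. I x)" if "x \<in> A" for x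
    using that by (subst nonneg_infsum_complete) (auto intro!: SUP_upper2[of "{x}"])
  then have fin: "I x < \<infinity>" if "x \<in> A" for x
    using assms that by (auto simp: I_def intro: le_less_trans)
  have summable: "(\<lambda>y. norm (c x y)) summable_on B x"
    and I: "I x = ennreal (\<Sum>\<^sub>\<infinity>y\<in>B x. norm (c x y))" if "x \<in> A" for x
    using infsum_ennreal_finite[of "B x" "\<lambda>y. norm (c x y)"] fin[OF that] by (auto simp: I_def)
  have "(\<Sum>\<^sub>\<infinity>x\<in>A. ennreal (\<Sum>\<^sub>\<infinity>y\<in>B x. norm (c x y))) = (\<Sum>\<^sub>\<infinity>x\<in>A. I x)"
    by (rule infsum_cong) (simp add: I)
  then have "(\<lambda>x. \<Sum>\<^sub>\<infinity>y\<in>B x. norm (c x y)) summable_on A"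
    using assms by (intro infsum_ennreal_finite(1)) (auto simp: I_def infsum_nonneg)
  then show ?thesis
    using summable Infinite_Sum.abs_summable_on_Sigma_iff[of "\<lambda>(x, y). c x y" A B]
    by (simp add: infsum_nonneg case_prod_unfold)
qed

section \<open>Transfer from basis expansions to cubes\<close>

text \<open>Any finite \<open>S\<close> containing the support of \<open>k\<close> will do, so the
  same number \<open>fourier_basis \<Phi> k v\<close> occurs in the expansions of all components for
  which \<open>k\<close> is active.\<close>

lemma fourier_basis_eq_torus_char:
  assumes "finite S" "k \<in> freqs_on S"
  shows "fourier_basis \<Phi> k v = torus_char S k (restrict (coord \<Phi> v) S)"
proof -
  have "(\<Sum>n. 2 * of_real pi * \<i> * of_int (k n) * of_real (coord \<Phi> v n))
      = (\<Sum>n\<in>S. 2 * of_real pi * \<i> * of_int (k n) * of_real (coord \<Phi> v n))"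
    using assms by (intro suminf_finite) (auto simp: freqs_on_def)
  then show ?thesis
    by (simp add: fourier_basis_def torus_char_def cis_conv_exp sum_distrib_left mult_ac)
qed

lemma freqs_on_support: "k \<in> freqs \<Longrightarrow> finite {i. k i \<noteq> 0} \<and> k \<in> freqs_on {i. k i \<noteq> 0}"
  by (auto simp: freqs_def freqs_on_def)

lemma fourier_integrand_eq_torus_char:
  assumes "finite S"
  shows "fourier_integrand \<Phi> S g k b = of_real (in_coords \<Phi> S g b) * torus_char S (\<lambda>i. - k i) b"
  by (simp add: fourier_integrand_def torus_char_prod[OF assms] cis_conv_exp mult_ac)

lemma fourier_integral_eq_cube_measure:
  assumes "finite S"
  shows "fourier_integral \<Phi> S g k
    = (\<integral>b. of_real (in_coords \<Phi> S g b) * torus_char S (\<lambda>i. - k i) b \<partial>cube_measure S)"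
  unfolding fourier_integral_def set_lebesgue_integral_def cube_measure_def
  using cube_sets[OF assms]
  by (subst integral_restrict_space) (auto simp: cube_Int_space fourier_integrand_eq_torus_char assms)

lemma in_coords_restrict_coord:
  "in_coords \<Phi> S g (restrict (coord \<Phi> v) S) = g (part \<Phi> S v)"
  by (simp add: in_coords_def part_def)

lemma restrict_coord_cube: "v \<in> L_bound \<Phi> \<Longrightarrow> restrict (coord \<Phi> v) S \<in> cube S"
  by (auto simp: L_bound_def cube_def)

theorem theorem1:
  fixes \<Phi> :: "nat \<Rightarrow> 'a::banach"
    and f :: "'a \<Rightarrow> real"
    and D :: "nat \<Rightarrow> nat set"
    and fs :: "nat \<Rightarrow> 'a \<Rightarrow> real"
  assumes "schauder_basis \<Phi>"
    and "finite_dim_summation \<Phi> f D fs"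
    and "\<forall>j. C1_on_cube (D j) (in_coords \<Phi> (D j) (fs j))"
    and "\<forall>k\<in>freqs. fourier_coeff_exists \<Phi> D fs k"
    and "(\<Sum>\<^sub>\<infinity>k\<in>freqs. \<Sum>\<^sub>\<infinity>j\<in>active D k.
            ennreal (norm (fourier_integral \<Phi> (D j) (fs j) k))) < \<infinity>"
  shows "\<forall>v\<in>L_bound \<Phi>.
           (\<lambda>k. fourier_coeff \<Phi> D fs k * fourier_basis \<Phi> k v) summable_on freqs \<and>
           complex_of_real (f v) =
             (\<Sum>\<^sub>\<infinity>k\<in>freqs. fourier_coeff \<Phi> D fs k * fourier_basis \<Phi> k v)"
proof
  fix v assume v: "v \<in> L_bound \<Phi>"
  define c where "c k j = fourier_integral \<Phi> (D j) (fs j) k" for k j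
  define e where "e k = fourier_basis \<Phi> k v" for k
  define P where "P = Sigma freqs (active D)"
  define Q where "Q = Sigma UNIV (\<lambda>j. freqs_on (D j))"
  have fin: "\<And>j. finite (D j)"
    and f_sums: "(\<lambda>j. fs j (part \<Phi> (D j) v)) sums f v"
    using assms(2) v by (auto simp: finite_dim_summation_def indivisible_decomposition_def)
  \<comment> \<open>The support of \<open>k\<close> serves as the coordinate set, since
    \<open>k\<close> need not be active for any component.\<close>
  have norm_e: "norm (e k) = 1" if "k \<in> freqs" for k
    using fourier_basis_eq_torus_char[of "{i. k i \<noteq> 0}" k \<Phi> v] freqs_on_support[OF that] by (simp add: e_def)
  \<comment> \<open>\<open>k\<close> lies in \<open>freqs_on (D j)\<close> exactly when
    \<open>j\<close> lies in \<open>active D k\<close>: \<open>P\<close> and \<open>Q\<close> list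
    the same pairs in opposite order.\<close>
  have bij: "bij_betw prod.swap Q P"
    by (rule bij_betwI[of _ _ _ prod.swap]) (auto simp: P_def Q_def active_def freqs_on_def)
  have c_P: "(\<lambda>(k, j). norm (c k j)) summable_on P"
    unfolding P_def c_def by (rule norm_summable_on_Sigma_ennrealI) fact
  have "(\<lambda>(j, k). norm (c k j)) summable_on Q"
    using summable_on_reindex_bij_betw[OF bij, of "\<lambda>(k, j). norm (c k j)"] c_P
    by (simp add: case_prod_unfold)
  then have c_j: "(\<lambda>k. norm (c k j)) summable_on freqs_on (D j)" for j
    unfolding Q_def by (rule summable_on_SigmaD1) simp
  have component: "((\<lambda>k. c k j * e k) has_sum complex_of_real (fs j (part \<Phi> (D j) v))) (freqs_on (D j))" for j
  proof -
    define F where "F b = complex_of_real (in_coords \<Phi> (D j) (fs j) b)" for b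
    have F_cont: "continuous_on (cube (D j)) F"
      using assms(3) unfolding F_def[abs_def] C1_on_cube_def by (intro continuous_intros) auto
    \<comment> \<open>The zero frequency is active for every \<open>j\<close>, and its integrand is
      the component itself, so the existence of this one coefficient makes every component
      integrable.\<close>
    have "(\<lambda>_. 0) \<in> freqs" "j \<in> active D (\<lambda>_. 0)"
      using freqs_on_zero by (auto simp: active_def freqs_def)
    then have "set_integrable (PiM (D j) (\<lambda>_. lborel)) (cube (D j))
        (fourier_integrand \<Phi> (D j) (fs j) (\<lambda>_. 0))"
      using assms(4) unfolding fourier_coeff_exists_def by blast
    moreover have "fourier_integrand \<Phi> (D j) (fs j) (\<lambda>_. 0) = F"
      by (auto simp: fourier_integrand_eq_torus_char fin torus_char_zero F_def)
    ultimately have F_int: "integrable (cube_measure (D j)) F"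
      unfolding cube_measure_def set_integrable_def using cube_sets[OF fin]
      by (subst integrable_restrict_space) (auto simp: cube_Int_space)
    have "((\<lambda>k. c k j * torus_char (D j) k (restrict (coord \<Phi> v) (D j)))
        has_sum F (restrict (coord \<Phi> v) (D j))) (freqs_on (D j))"
      using fin F_cont F_int _ c_j restrict_coord_cube[OF v]
      by (rule fourier_series_has_sum) (simp add: c_def F_def fourier_integral_eq_cube_measure fin)
    then have "((\<lambda>k. c k j * torus_char (D j) k (restrict (coord \<Phi> v) (D j)))
        has_sum of_real (fs j (part \<Phi> (D j) v))) (freqs_on (D j))"
      by (simp add: F_def in_coords_restrict_coord)
    moreover have "torus_char (D j) k (restrict (coord \<Phi> v) (D j)) = e k" if "k \<in> freqs_on (D j)" for k
      unfolding e_def using fin that by (rule fourier_basis_eq_torus_char[symmetric])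
    ultimately show ?thesis by (simp cong: has_sum_cong)
  qed
  have "(\<lambda>z. norm (case z of (k, j) \<Rightarrow> c k j * e k)) summable_on P"
    using c_P by (rule summable_on_cong[THEN iffD1, rotated])
      (auto simp: P_def norm_mult norm_e)
  then obtain W where W: "((\<lambda>(k, j). c k j * e k) has_sum W) P"
    using Infinite_Sum.abs_summable_summable has_sum_infsum by blast
  then have W': "((\<lambda>(j, k). c k j * e k) has_sum W) Q"
    using has_sum_reindex_bij_betw[OF bij, of "\<lambda>(k, j). c k j * e k"]
    by (simp add: case_prod_unfold)
  \<comment> \<open>Summing the double series over \<open>k\<close> first collapses each inner sum
    to a component.\<close>
  have "((\<lambda>j. complex_of_real (fs j (part \<Phi> (D j) v))) has_sum W) UNIV"
    using W'[unfolded Q_def] by (rule has_sum_SigmaD) (simp add: component)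
  then have "(\<lambda>j. complex_of_real (fs j (part \<Phi> (D j) v))) sums W"
    by (rule has_sum_imp_sums)
  \<comment> \<open>The decomposition of \<open>f\<close> converges in the order of
    \<open>j\<close>. The unconditional sum \<open>W\<close> is also the limit in that order, and
    limits are unique.\<close>
  then have W_eq: "W = complex_of_real (f v)"
    using sums_of_real[OF f_sums] by (rule sums_unique2)
  \<comment> \<open>The same double series summed over \<open>j\<close> first: \<open>e k\<close>
    factors out and leaves the Fourier coefficient.\<close>
  have "((\<lambda>k. fourier_coeff \<Phi> D fs k * e k) has_sum W) freqs"
  proof (rule has_sum_SigmaD[OF W[unfolded P_def]])
    fix k assume "k \<in> freqs"
    then have "((\<lambda>j. c k j) has_sum fourier_coeff \<Phi> D fs k) (active D k)"
      using assms(4) unfolding fourier_coeff_exists_def fourier_coeff_def c_def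
      by (intro has_sum_infsum) auto
    then show "((\<lambda>j. case (k, j) of (k, j) \<Rightarrow> c k j * e k) has_sum fourier_coeff \<Phi> D fs k * e k) (active D k)"
      by (simp add: has_sum_cmult_left)
  qed
  then show "(\<lambda>k. fourier_coeff \<Phi> D fs k * fourier_basis \<Phi> k v) summable_on freqs \<and>
      complex_of_real (f v) = (\<Sum>\<^sub>\<infinity>k\<in>freqs. fourier_coeff \<Phi> D fs k * fourier_basis \<Phi> k v)"
    by (simp add: has_sum_iff e_def W_eq)
qed

end
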